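(* Let $c,\phi\in\mathbb{R}$ with $\phi\neq0$, and let $K(s)$ be a continuous function on an interval containing $s_0$ and not containing $0$. Then there exists a 2-parameter family of helicoidal surfaces of i-type in $\mathbb{I}^3$ with $K$ as the Gaussian curvature (i.e. the Gaussian curvature at the point with parameters $(s,t)$ is $K(s)$) and whose generating curves $\alpha_{k_0,k_1}(s)=(s,0,z(s))$, $s$ arc-length parameter, satisfy, on intervals around $s_0$ on which the quantity under the square root is positive, $$z(s)=k_0+\int_{s_0}^{s}\left(k_1-\frac{c^2}{\phi^2v^2}+2\int_{s_0}^{v}w\,K(w)\,dw\right)^{\frac12}dv,$$ where $k_0,k_1$ are constants depending on the values of $z,z'$ at $s=s_0$.
   Context: The simply isotropic space $\mathbb{I}^3$ is $\mathbb{R}^3$ with the degenerate metric $\langle u,v\rangle_z=u^1v^1+u^2v^2$. For a $C^2$ parameterized surface $\mathbf{x}(u^1,u^2)=(x^1,x^2,x^3)$ write $\mathbf{x}_i=\partial\mathbf{x}/\partial u^i$, $\mathbf{x}_{ij}=\partial^2\mathbf{x}/\partial u^i\partial u^j$, $x^i_k=\partial x^i/\partial u^k$, $X_{ij}=x^i_1x^j_2-x^j_1x^i_2$. The surface is admissible if $X_{12}\neq0$ (equivalently, the induced metric has rank 2). Put $g_{ij}=\langle\mathbf{x}_i,\mathbf{x}_j\rangle_z$, $N_h=\left(\frac{X_{23}}{X_{12}},\frac{X_{31}}{X_{12}},1\right)$, $h_{ij}=\langle N_h,\mathbf{x}_{ij}\rangle$ (Euclidean inner product). The Gaussian and mean curvatures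 are $$K=\frac{h_{11}h_{22}-h_{12}^2}{g_{11}g_{22}-g_{12}^2},\qquad H=\frac12\,\frac{g_{11}h_{22}-2g_{12}h_{12}+g_{22}h_{11}}{g_{11}g_{22}-g_{12}^2};$$ equivalently $K=\det L$, $H=\frac12\mathrm{tr}\,L$ with $L=-D\xi$, $\xi=\left(A,B,\frac12(1-A^2-B^2)\right)$, $A=X_{23}/X_{12}$, $B=X_{31}/X_{12}$. The helicoidal surface of i-type with generating curve $\alpha(u)=(x(u),0,z(u))$ (a $C^2$ curve) and parameters $c,\phi$ is $$Z_2(u,t)=(x(u)\cos(t\phi),\ x(u)\sin(t\phi),\ z(u)+ct),$$ with coordinates $(u^1,u^2)=(u,t)$. Surfaces are assumed admissible, which here means $\phi\,x\,x'\neq0$. *)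

theory Defs
  imports "HOL-Analysis.Analysis"
begin

text \<open>
  A parameterized surface is a map \<open>x u t\<close> (with \<open>u = u\<^sup>1\<close>, \<open>t = u\<^sup>2\<close>) considered on a product
  \<open>U \<times> T\<close> of nondegenerate intervals.  Derivatives are taken within these intervals, so they are the
  usual ones at interior points and one-sided at an endpoint that belongs to the interval.
\<close>

definition partial1 ::
  "real set \<Rightarrow> (real \<Rightarrow> real \<Rightarrow> 'a::real_normed_vector) \<Rightarrow> real \<Rightarrow> real \<Rightarrow> 'a" where
  "partial1 U x u t = vector_derivative (\<lambda>v. x v t) (at u within U)"

definition partial2 ::
  "real set \<Rightarrow> (real \<Rightarrow> real \<Rightarrow> 'a::real_normed_vector) \<Rightarrow> real \<Rightarrow> real \<Rightarrow> 'a" where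
  "partial2 T x u t = vector_derivative (\<lambda>r. x u r) (at t within T)"

definition C1_curve :: "real set \<Rightarrow> (real \<Rightarrow> 'a::real_normed_vector) \<Rightarrow> bool" where
  "C1_curve J f \<longleftrightarrow>
     (\<forall>u\<in>J. f differentiable (at u within J)) \<and>
     continuous_on J (\<lambda>u. vector_derivative f (at u within J))"

definition C2_curve :: "real set \<Rightarrow> (real \<Rightarrow> 'a::real_normed_vector) \<Rightarrow> bool" where
  "C2_curve J f \<longleftrightarrow>
     C1_curve J f \<and> C1_curve J (\<lambda>u. vector_derivative f (at u within J))"

definition C1_surface ::
  "real set \<Rightarrow> real set \<Rightarrow> (real \<Rightarrow> real \<Rightarrow> 'a::real_normed_vector) \<Rightarrow> bool" where
  "C1_surface U T x \<longleftrightarrow>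
     (\<forall>u\<in>U. \<forall>t\<in>T. (\<lambda>v. x v t) differentiable (at u within U) \<and>
                   (\<lambda>r. x u r) differentiable (at t within T)) \<and>
     continuous_on (U \<times> T) (\<lambda>(u, t). partial1 U x u t) \<and>
     continuous_on (U \<times> T) (\<lambda>(u, t). partial2 T x u t)"

definition C2_surface ::
  "real set \<Rightarrow> real set \<Rightarrow> (real \<Rightarrow> real \<Rightarrow> 'a::real_normed_vector) \<Rightarrow> bool" where
  "C2_surface U T x \<longleftrightarrow>
     C1_surface U T x \<and> C1_surface U T (partial1 U x) \<and> C1_surface U T (partial2 T x)"

definition iso_inner :: "real^3 \<Rightarrow> real^3 \<Rightarrow> real" where
  "iso_inner p q = p $ 1 * q $ 1 + p $ 2 * q $ 2"

text \<open>\<open>minor p q i j\<close> is \<open>X\<^sub>i\<^sub>j\<close> for the tangent vectors \<open>p = x\<^sub>1\<close> and \<open>q = x\<^sub>2\<close>.\<close>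

definition minor :: "real^3 \<Rightarrow> real^3 \<Rightarrow> 3 \<Rightarrow> 3 \<Rightarrow> real" where
  "minor p q i j = p $ i * q $ j - p $ j * q $ i"

definition admissible :: "real set \<Rightarrow> real set \<Rightarrow> (real \<Rightarrow> real \<Rightarrow> real^3) \<Rightarrow> bool" where
  "admissible U T x \<longleftrightarrow>
     C2_surface U T x \<and>
     (\<forall>u\<in>U. \<forall>t\<in>T. minor (partial1 U x u t) (partial2 T x u t) 1 2 \<noteq> 0)"

definition iso_normal :: "real^3 \<Rightarrow> real^3 \<Rightarrow> real^3" where
  "iso_normal p q = vector [minor p q 2 3 / minor p q 1 2, minor p q 3 1 / minor p q 1 2, 1]"

definition gaussian_curvature ::
  "real set \<Rightarrow> real set \<Rightarrow> (real \<Rightarrow> real \<Rightarrow> real^3) \<Rightarrow> real \<Rightarrow> real \<Rightarrow> real" where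
  "gaussian_curvature U T x u t =
     (let x1 = partial1 U x u t; x2 = partial2 T x u t;
          x11 = partial1 U (partial1 U x) u t;
          x12 = partial1 U (partial2 T x) u t;
          x22 = partial2 T (partial2 T x) u t;
          N = iso_normal x1 x2;
          h11 = N \<bullet> x11; h12 = N \<bullet> x12; h22 = N \<bullet> x22;
          g11 = iso_inner x1 x1; g12 = iso_inner x1 x2; g22 = iso_inner x2 x2
      in (h11 * h22 - h12\<^sup>2) / (g11 * g22 - g12\<^sup>2))"

definition generating_curve :: "(real \<Rightarrow> real) \<Rightarrow> (real \<Rightarrow> real) \<Rightarrow> real \<Rightarrow> real^3" where
  "generating_curve x z u = vector [x u, 0, z u]"

definition helicoidal_surface ::
  "real \<Rightarrow> real \<Rightarrow> (real \<Rightarrow> real) \<Rightarrow> (real \<Rightarrow> real) \<Rightarrow> real \<Rightarrow> real \<Rightarrow> real^3" where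
  "helicoidal_surface c \<phi> x z u t = vector [x u * cos (t * \<phi>), x u * sin (t * \<phi>), z u + c * t]"

text \<open>Arc length is measured with the degenerate metric.\<close>

definition arclength_param :: "real set \<Rightarrow> (real \<Rightarrow> real^3) \<Rightarrow> bool" where
  "arclength_param J \<alpha> \<longleftrightarrow>
     (\<forall>u\<in>J. let a = vector_derivative \<alpha> (at u within J) in sqrt (iso_inner a a) = 1)"

text \<open>
  The quantity under the square root.  The integral is oriented, i.e. it changes sign when its
  bounds are swapped, so that \<open>v < s0\<close> is allowed.
\<close>

definition radicand :: "real \<Rightarrow> real \<Rightarrow> (real \<Rightarrow> real) \<Rightarrow> real \<Rightarrow> real \<Rightarrow> real \<Rightarrow> real" where
  "radicand c \<phi> K s0 k1 v =
     k1 - c\<^sup>2 / (\<phi>\<^sup>2 * v\<^sup>2) + 2 * (LBINT w=ereal s0..ereal v. w * K w)"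

end

theory Submission
  imports Defs
begin

text \<open>
  On the helicoidal surface with profile \<open>(s, 0, z s)\<close> the metric coefficients are \<open>1\<close>, \<open>0\<close> and
  \<open>\<phi>\<^sup>2 s\<^sup>2\<close>, the coefficients of the second form are \<open>z''\<close>, \<open>- c / s\<close> and \<open>\<phi>\<^sup>2 s z'\<close>, and hence
  \<open>K = z' z'' / s - c\<^sup>2 / (\<phi>\<^sup>2 s\<^sup>4)\<close> (\<open>helicoidal_arclength\<close>).  Because \<open>2 z' z''\<close> is the derivative of
  \<open>(z')\<^sup>2\<close>, prescribing \<open>K\<close> is the first-order linear condition
  \<open>((z')\<^sup>2)' = 2 s K + 2 c\<^sup>2 / (\<phi>\<^sup>2 s\<^sup>3)\<close> on \<open>(z')\<^sup>2\<close>.  The radicand is its general solution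
  (\<open>radicand_has_real_derivative\<close>), with \<open>k1\<close> as the constant of integration.  So one takes
  \<open>z' = sqrt (radicand)\<close> wherever the radicand is positive, and a second integration brings in \<open>k0\<close>.

  The profile \<open>z\<close> is given by one formula for all intervals \<open>J\<close>, which only has to be differentiated
  within \<open>J\<close>, possibly at an endpoint of \<open>J\<close>.  A suitable \<open>J\<close> exists as soon as the
  radicand is positive at \<open>s0\<close>, by its continuity on \<open>I\<close>.
\<close>

section \<open>Calculus on an interval that may contain its endpoints\<close>

lemma interval_at_within_neq_bot:
  fixes J :: "real set"
  assumes "is_interval J" "interior J \<noteq> {}" "u \<in> J"
  shows "at u within J \<noteq> bot"
proof -
  have "connected J"
    using assms(1) by (simp add: is_interval_connected)
  moreover have "J \<noteq> {x}" for x
    using assms(2) by auto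
  ultimately have "u islimpt J"
    using assms(3) by (intro connected_imp_perfect)
  then show ?thesis
    by (simp add: trivial_limit_within)
qed

text \<open>
  This carries the fundamental theorem of calculus over from compact intervals to general ones,
  because a derivative within \<open>J\<close> at \<open>x\<close> only depends on the part of \<open>J\<close> near \<open>x\<close>:
  it suffices that \<open>{a..b}\<close> reaches beyond \<open>x\<close> on each side on which \<open>J\<close> does.
\<close>

lemma interval_at_within_Icc:
  fixes J :: "real set"
  assumes J: "is_interval J" and "s \<in> J" "x \<in> J"
  obtains a b where "{a..b} \<subseteq> J" "a \<le> s" "s \<le> b" "a \<le> x" "x \<le> b"
    and "at x within J = at x within {a..b}"
proof -
  obtain b where b: "b \<in> J" "s \<le> b" "x \<le> b" "x < b \<or> (\<forall>y\<in>J. y \<le> x)"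
  proof (cases "\<forall>y\<in>J. y \<le> x")
    case True
    then show ?thesis using that[of x] assms by auto
  next
    case False
    then obtain y where "y \<in> J" "x < y" by auto
    then show ?thesis using that[of "max y s"] assms by (auto simp: max_def)
  qed
  obtain a where a: "a \<in> J" "a \<le> s" "a \<le> x" "a < x \<or> (\<forall>y\<in>J. x \<le> y)"
  proof (cases "\<forall>y\<in>J. x \<le> y")
    case True
    then show ?thesis using that[of x] assms by auto
  next
    case False
    then obtain y where "y \<in> J" "y < x" by auto
    then show ?thesis using that[of "min y s"] assms by (auto simp: min_def)
  qed
  have sub: "{a..b} \<subseteq> J"
    using mem_is_interval_1_I[OF J a(1) b(1)] by auto
  \<comment> \<open>\<open>S\<close> cuts \<open>J\<close> off only on a side where \<open>{a..b}\<close> extends beyond \<open>x\<close>; on the other side \<open>J\<close> itself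
    ends at \<open>x\<close>.\<close>
  define S where "S = (if a < x then {a<..} else UNIV) \<inter> (if x < b then {..<b} else UNIV)"
  have "J \<inter> S - {x} = {a..b} \<inter> S - {x}"
  proof (intro set_eqI iffI)
    fix y assume y: "y \<in> J \<inter> S - {x}"
    then have "a \<le> y"
      using a(3,4) by (cases "a < x") (auto simp: S_def)
    moreover have "y \<le> b"
      using b(3,4) y by (cases "x < b") (auto simp: S_def)
    ultimately show "y \<in> {a..b} \<inter> S - {x}"
      using y by simp
  next
    fix y assume "y \<in> {a..b} \<inter> S - {x}"
    then show "y \<in> J \<inter> S - {x}"
      using sub by blast
  qed
  moreover have "open S" "x \<in> S"
    by (auto simp: S_def)
  ultimately have "at x within J = at x within {a..b}"
    using at_within_nhd[of x S J "{a..b}"] by simp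
  with sub a(2,3) b(2,3) show thesis
    by (intro that)
qed

lemma interval_integral_has_vector_derivative:
  fixes f :: "real \<Rightarrow> 'a::euclidean_space"
  assumes "is_interval J" "s \<in> J" "x \<in> J" "continuous_on J f"
  shows "((\<lambda>u. LBINT v=ereal s..ereal u. f v) has_vector_derivative f x) (at x within J)"
proof -
  obtain a b where ab: "{a..b} \<subseteq> J" "a \<le> s" "s \<le> b" "a \<le> x" "x \<le> b"
    and eq: "at x within J = at x within {a..b}"
    using assms(1-3) by (rule interval_at_within_Icc)
  have "continuous_on {a..b} f"
    using assms(4) ab(1) by (rule continuous_on_subset)
  then show ?thesis
    unfolding eq using ab(2-5) by (intro interval_integral_FTC2)
qed

section \<open>Regularity from explicit derivatives\<close>

lemma vector_3_axis: "(vector [a, b, c] :: real^3) = a *\<^sub>R axis 1 1 + b *\<^sub>R axis 2 1 + c *\<^sub>R axis 3 1"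
  by (simp add: vec_eq_iff forall_3 axis_def)

lemma has_vector_derivative_vector_3:
  fixes a b c :: "real \<Rightarrow> real"
  assumes "(a has_real_derivative a') F" "(b has_real_derivative b') F" "(c has_real_derivative c') F"
  shows "((\<lambda>v. vector [a v, b v, c v] :: real^3) has_vector_derivative vector [a', b', c']) F"
  using assms unfolding vector_3_axis has_real_derivative_iff_has_vector_derivative
  by (intro has_vector_derivative_add
      bounded_linear.has_vector_derivative[OF bounded_linear_scaleR_left])

lemma continuous_on_vector_3:
  fixes a b c :: "'a::topological_space \<Rightarrow> real"
  assumes "continuous_on S a" "continuous_on S b" "continuous_on S c"
  shows "continuous_on S (\<lambda>v. vector [a v, b v, c v] :: real^3)"
  unfolding vector_3_axis using assms by (intro continuous_intros)

text \<open>
  In the next two lemmas the map \<open>f\<close> (or \<open>x\<close>) may differ outside the domain from the explicit map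
  that is differentiated.  This is what allows them to be applied a second time, to a derivative
  whose formula is only known on the domain.
\<close>

lemma C1_curveI:
  assumes "\<And>u. u \<in> J \<Longrightarrow> at u within J \<noteq> bot"
    and "\<And>u. u \<in> J \<Longrightarrow> f u = g u"
    and "\<And>u. u \<in> J \<Longrightarrow> (g has_vector_derivative g' u) (at u within J)"
    and "continuous_on J g'"
  shows "C1_curve J f" and "\<And>u. u \<in> J \<Longrightarrow> vector_derivative f (at u within J) = g' u"
proof -
  have d: "(f has_vector_derivative g' u) (at u within J)" if "u \<in> J" for u
    using has_vector_derivative_transform[OF that assms(2) assms(3)] that by simp
  show eq: "vector_derivative f (at u within J) = g' u" if "u \<in> J" for u
    using assms(1) d that by (intro vector_derivative_within) auto
  show "C1_curve J f"
    unfolding C1_curve_def using d assms(4) eq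
    by (auto intro: differentiableI_vector cong: continuous_on_cong)
qed

lemma C1_surfaceI:
  assumes "\<And>u. u \<in> U \<Longrightarrow> at u within U \<noteq> bot" and "\<And>t. t \<in> T \<Longrightarrow> at t within T \<noteq> bot"
    and "\<And>u t. u \<in> U \<Longrightarrow> t \<in> T \<Longrightarrow> x u t = y u t"
    and "\<And>u t. u \<in> U \<Longrightarrow> t \<in> T \<Longrightarrow> ((\<lambda>v. y v t) has_vector_derivative y1 u t) (at u within U)"
    and "\<And>u t. u \<in> U \<Longrightarrow> t \<in> T \<Longrightarrow> ((\<lambda>r. y u r) has_vector_derivative y2 u t) (at t within T)"
    and "continuous_on (U \<times> T) (\<lambda>(u, t). y1 u t)" and "continuous_on (U \<times> T) (\<lambda>(u, t). y2 u t)"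
  shows "C1_surface U T x"
    and "\<And>u t. u \<in> U \<Longrightarrow> t \<in> T \<Longrightarrow> partial1 U x u t = y1 u t"
    and "\<And>u t. u \<in> U \<Longrightarrow> t \<in> T \<Longrightarrow> partial2 T x u t = y2 u t"
proof -
  have d1: "((\<lambda>v. x v t) has_vector_derivative y1 u t) (at u within U)" if "u \<in> U" "t \<in> T" for u t
    using has_vector_derivative_transform[OF that(1) assms(3) assms(4)] that by simp
  have d2: "((\<lambda>r. x u r) has_vector_derivative y2 u t) (at t within T)" if "u \<in> U" "t \<in> T" for u t
    using has_vector_derivative_transform[OF that(2) assms(3) assms(5)] that by simp
  show p1: "partial1 U x u t = y1 u t" if "u \<in> U" "t \<in> T" for u t
    unfolding partial1_def using assms(1) d1 that by (intro vector_derivative_within) auto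
  show p2: "partial2 T x u t = y2 u t" if "u \<in> U" "t \<in> T" for u t
    unfolding partial2_def using assms(2) d2 that by (intro vector_derivative_within) auto
  have "continuous_on (U \<times> T) (\<lambda>(u, t). partial1 U x u t)"
    using assms(6) by (rule continuous_on_eq) (auto simp: p1)
  moreover have "continuous_on (U \<times> T) (\<lambda>(u, t). partial2 T x u t)"
    using assms(7) by (rule continuous_on_eq) (auto simp: p2)
  ultimately show "C1_surface U T x"
    unfolding C1_surface_def using differentiableI_vector[OF d1] differentiableI_vector[OF d2] by blast
qed

section \<open>Helicoidal surfaces over an arc-length parameterized profile\<close>

lemma arclength_profile:
  assumes J: "is_interval J" "interior J \<noteq> {}"
    and z: "\<And>s. s \<in> J \<Longrightarrow> (z has_real_derivative p s) (at s within J)"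
    and p: "\<And>s. s \<in> J \<Longrightarrow> (p has_real_derivative q s) (at s within J)"
    and q: "continuous_on J q"
  shows "C2_curve J (generating_curve (\<lambda>s. s) z)"
    and "arclength_param J (generating_curve (\<lambda>s. s) z)"
proof -
  have pc: "continuous_on J p"
    using p by (meson DERIV_continuous continuous_on_eq_continuous_within)
  note nb = interval_at_within_neq_bot[OF J]
  have dg: "(generating_curve (\<lambda>s. s) z has_vector_derivative vector [1, 0, p s]) (at s within J)"
    if "s \<in> J" for s
    unfolding generating_curve_def[abs_def] using z[OF that]
    by (intro has_vector_derivative_vector_3) (auto intro!: derivative_eq_intros)
  have cg: "continuous_on J (\<lambda>s. vector [1, 0, p s] :: real^3)"
    by (intro continuous_on_vector_3 continuous_intros pc)
  note c1 = C1_curveI(1)[OF nb refl dg cg] and d1 = C1_curveI(2)[OF nb refl dg cg]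
  have "C1_curve J (\<lambda>s. vector_derivative (generating_curve (\<lambda>s. s) z) (at s within J))"
    using p q
    by (intro C1_curveI(1)[where g' = "\<lambda>s. vector [0, 0, q s]", OF nb d1])
      (auto intro!: has_vector_derivative_vector_3 continuous_on_vector_3 continuous_intros)
  with c1 show "C2_curve J (generating_curve (\<lambda>s. s) z)"
    unfolding C2_curve_def ..
  show "arclength_param J (generating_curve (\<lambda>s. s) z)"
    by (simp add: arclength_param_def d1 iso_inner_def)
qed

text \<open>
  Here \<open>p = z'\<close> and \<open>q = z''\<close>.  The curvature does not depend on \<open>t\<close> because helicoidal motions are
  isometries; in the computation, \<open>t\<close> disappears from each coefficient by \<open>cos\<^sup>2 + sin\<^sup>2 = 1\<close>.  The mixed coefficient \<open>- c / s\<close> is the source of the term in \<open>c\<close>.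
\<close>

lemma helicoidal_arclength:
  fixes J :: "real set"
  assumes J: "is_interval J" "interior J \<noteq> {}" "0 \<notin> J" and phi: "\<phi> \<noteq> 0"
    and z: "\<And>s. s \<in> J \<Longrightarrow> (z has_real_derivative p s) (at s within J)"
    and p: "\<And>s. s \<in> J \<Longrightarrow> (p has_real_derivative q s) (at s within J)"
    and q: "continuous_on J q"
  shows "admissible J UNIV (helicoidal_surface c \<phi> (\<lambda>s. s) z)"
    and "\<And>s t. s \<in> J \<Longrightarrow>
      gaussian_curvature J UNIV (helicoidal_surface c \<phi> (\<lambda>s. s) z) s t
        = p s * q s / s - c\<^sup>2 / (\<phi>\<^sup>2 * s ^ 4)"
proof -
  have pc: "continuous_on J p"
    using p by (meson DERIV_continuous continuous_on_eq_continuous_within)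
  have pc': "continuous_on (J \<times> UNIV) (\<lambda>w::real\<times>real. p (fst w))"
    by (rule continuous_on_compose2[OF pc]) (auto intro: continuous_intros)
  have qc': "continuous_on (J \<times> UNIV) (\<lambda>w::real\<times>real. q (fst w))"
    by (rule continuous_on_compose2[OF q]) (auto intro: continuous_intros)
  note nb = interval_at_within_neq_bot[OF J(1,2)]
  have nb': "at t within UNIV \<noteq> bot" for t :: real
    by simp
  let ?x = "helicoidal_surface c \<phi> (\<lambda>s. s) z"
  define x1 :: "real \<Rightarrow> real \<Rightarrow> real^3" where
    "x1 s t = vector [cos (t * \<phi>), sin (t * \<phi>), p s]" for s t
  define x2 :: "real \<Rightarrow> real \<Rightarrow> real^3" where
    "x2 s t = vector [- (\<phi> * s * sin (t * \<phi>)), \<phi> * s * cos (t * \<phi>), c]" for s t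
  define x11 :: "real \<Rightarrow> real \<Rightarrow> real^3" where "x11 s t = vector [0, 0, q s]" for s t
  define x12 :: "real \<Rightarrow> real \<Rightarrow> real^3" where
    "x12 s t = vector [- (\<phi> * sin (t * \<phi>)), \<phi> * cos (t * \<phi>), 0]" for s t
  define x22 :: "real \<Rightarrow> real \<Rightarrow> real^3" where
    "x22 s t = vector [- (\<phi>\<^sup>2 * s * cos (t * \<phi>)), - (\<phi>\<^sup>2 * s * sin (t * \<phi>)), 0]" for s t
  have dx1: "((\<lambda>v. ?x v t) has_vector_derivative x1 s t) (at s within J)" if "s \<in> J" for s t
    unfolding helicoidal_surface_def x1_def using z[OF that]
    by (intro has_vector_derivative_vector_3) (auto intro!: derivative_eq_intros)
  have dx2: "((\<lambda>r. ?x s r) has_vector_derivative x2 s t) (at t within UNIV)" for s t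
    unfolding helicoidal_surface_def x2_def
    by (intro has_vector_derivative_vector_3) (auto intro!: derivative_eq_intros)
  have dx11: "((\<lambda>v. x1 v t) has_vector_derivative x11 s t) (at s within J)" if "s \<in> J" for s t
    unfolding x1_def x11_def using p[OF that]
    by (intro has_vector_derivative_vector_3) (auto intro!: derivative_eq_intros)
  have dx12: "((\<lambda>r. x1 s r) has_vector_derivative x12 s t) (at t within UNIV)" for s t
    unfolding x1_def x12_def
    by (intro has_vector_derivative_vector_3) (auto intro!: derivative_eq_intros)
  have dx21: "((\<lambda>v. x2 v t) has_vector_derivative x12 s t) (at s within J)" for s t
    unfolding x2_def x12_def
    by (intro has_vector_derivative_vector_3) (auto intro!: derivative_eq_intros)
  have dx22: "((\<lambda>r. x2 s r) has_vector_derivative x22 s t) (at t within UNIV)" for s t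
    unfolding x2_def x22_def
    by (intro has_vector_derivative_vector_3)
      (auto intro!: derivative_eq_intros simp: power2_eq_square)
  have cont: "continuous_on (J \<times> UNIV) (\<lambda>(s, t). x1 s t)"
    "continuous_on (J \<times> UNIV) (\<lambda>(s, t). x2 s t)"
    "continuous_on (J \<times> UNIV) (\<lambda>(s, t). x11 s t)"
    "continuous_on (J \<times> UNIV) (\<lambda>(s, t). x12 s t)"
    "continuous_on (J \<times> UNIV) (\<lambda>(s, t). x22 s t)"
    unfolding x1_def x2_def x11_def x12_def x22_def case_prod_beta
    by (intro continuous_on_vector_3 pc' qc' continuous_intros)+
  note C = C1_surfaceI[OF nb nb' refl dx1 dx2 cont(1,2), simplified]
  note C1 = C1_surfaceI[OF nb nb' C(2) dx11 dx12 cont(3,4), simplified]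
  note C2 = C1_surfaceI[OF nb nb' C(3) dx21 dx22 cont(4,5), simplified]
  have minor12: "minor (x1 s t) (x2 s t) 1 2 = \<phi> * s" for s t
  proof -
    have "minor (x1 s t) (x2 s t) 1 2 = \<phi> * s * ((cos (t * \<phi>))\<^sup>2 + (sin (t * \<phi>))\<^sup>2)"
      unfolding minor_def x1_def x2_def vector_3 by algebra
    then show ?thesis by simp
  qed
  show "admissible J UNIV ?x"
    unfolding admissible_def C2_surface_def using C C1 C2 minor12 phi J(3) by auto
  show "gaussian_curvature J UNIV ?x s t = p s * q s / s - c\<^sup>2 / (\<phi>\<^sup>2 * s ^ 4)"
    if s: "s \<in> J" for s t
  proof -
    have s0: "s \<noteq> 0" using s J(3) by auto
    let ?N = "iso_normal (x1 s t) (x2 s t)"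
    \<comment> \<open>The trigonometric terms are treated as atoms \<open>C\<close> and \<open>S\<close>, so that algebraic normalization does
      not rewrite the argument \<open>t * \<phi>\<close>.\<close>
    define C where "C = cos (t * \<phi>)"
    define S where "S = sin (t * \<phi>)"
    have cs: "C * C = 1 - S * S"
      unfolding C_def S_def using sin_cos_squared_add3[of "t * \<phi>"] by linarith
    note x_CS = x1_def[of s t, folded C_def S_def] x2_def[of s t, folded C_def S_def]
      x11_def[of s t] x12_def[of s t, folded C_def S_def] x22_def[of s t, folded C_def S_def]
    have N: "?N = vector [(S * c - p s * (\<phi> * s * C)) / (\<phi> * s),
        (- p s * (\<phi> * s * S) - C * c) / (\<phi> * s), 1]"
      unfolding iso_normal_def minor12 by (simp add: minor_def x_CS algebra_simps)
    have h11: "?N \<bullet> x11 s t = q s"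
      unfolding N by (simp add: x_CS inner_vec_def sum_3)
    have "?N \<bullet> x12 s t = - c * (C * C + S * S) / s"
      unfolding N using s0 phi by (simp add: x_CS inner_vec_def sum_3 field_simps)
    then have h12: "?N \<bullet> x12 s t = - c / s"
      by (simp add: cs)
    have "?N \<bullet> x22 s t = \<phi>\<^sup>2 * s * p s * (C * C + S * S)"
      unfolding N using s0 phi
      by (simp add: x_CS inner_vec_def sum_3 field_simps power2_eq_square)
    then have h22: "?N \<bullet> x22 s t = \<phi>\<^sup>2 * s * p s"
      by (simp add: cs)
    have g11: "iso_inner (x1 s t) (x1 s t) = 1"
      by (simp add: iso_inner_def x_CS cs)
    have g12: "iso_inner (x1 s t) (x2 s t) = 0"
      by (simp add: iso_inner_def x_CS)
    have "iso_inner (x2 s t) (x2 s t) = \<phi>\<^sup>2 * s\<^sup>2 * (C * C + S * S)"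
      by (simp add: iso_inner_def x_CS algebra_simps power2_eq_square)
    then have g22: "iso_inner (x2 s t) (x2 s t) = \<phi>\<^sup>2 * s\<^sup>2"
      by (simp add: cs)
    have "gaussian_curvature J UNIV ?x s t
        = (q s * (\<phi>\<^sup>2 * s * p s) - (- c / s)\<^sup>2) / (1 * (\<phi>\<^sup>2 * s\<^sup>2) - 0\<^sup>2)"
      unfolding gaussian_curvature_def Let_def
      using s by (simp only: C C1 C2 h11 h12 h22 g11 g12 g22)
    also have "\<dots> = p s * q s / s - c\<^sup>2 / (\<phi>\<^sup>2 * s ^ 4)"
      using s0 phi by (simp add: field_simps power2_eq_square power4_eq_xxxx)
    finally show ?thesis .
  qed
qed

section \<open>The profile with prescribed curvature\<close>

lemma radicand_base [simp]: "radicand c \<phi> K s k s = k - c\<^sup>2 / (\<phi>\<^sup>2 * s\<^sup>2)"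
  by (simp add: radicand_def)

lemma radicand_has_real_derivative:
  assumes "is_interval J" "s0 \<in> J" "s \<in> J" "0 \<notin> J" "\<phi> \<noteq> 0" "continuous_on J K"
  shows "(radicand c \<phi> K s0 k1 has_real_derivative 2 * (c\<^sup>2 / (\<phi>\<^sup>2 * s ^ 3) + s * K s))
    (at s within J)"
proof -
  have "continuous_on J (\<lambda>w. w * K w)"
    using assms(6) by (intro continuous_intros)
  then have "((\<lambda>v. LBINT w=ereal s0..ereal v. w * K w) has_real_derivative s * K s) (at s within J)"
    unfolding has_real_derivative_iff_has_vector_derivative
    using assms by (intro interval_integral_has_vector_derivative) auto
  moreover have "s \<noteq> 0"
    using assms by auto
  ultimately show ?thesis
    unfolding radicand_def using assms(5)
    by (auto intro!: derivative_eq_intros simp: field_simps power2_eq_square power3_eq_cube)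
qed

lemma continuous_on_radicand:
  assumes "is_interval J" "s0 \<in> J" "0 \<notin> J" "\<phi> \<noteq> 0" "continuous_on J K"
  shows "continuous_on J (radicand c \<phi> K s0 k1)"
  using radicand_has_real_derivative[OF assms(1,2) _ assms(3-5)]
  by (meson DERIV_continuous continuous_on_eq_continuous_within)

text \<open>
  The point \<open>s\<close> may be an endpoint of \<open>I\<close>, but it always lies in the closure of the interior of \<open>I\<close>
  because \<open>I\<close> is convex.
\<close>

lemma interior_interval_Int_ball:
  fixes I :: "real set"
  assumes "is_interval I" "interior I \<noteq> {}" "s \<in> I" "e > 0"
  shows "interior (I \<inter> ball s e) \<noteq> {}"
proof -
  have "s \<in> closure (interior I)"
    using assms by (metis closure_subset convex_closure_interior is_interval_convex subsetD)
  then obtain y where "y \<in> interior I" "dist y s < e"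
    using assms(4) by (meson closure_approachable)
  then have "y \<in> interior (I \<inter> ball s e)"
    by (simp add: dist_commute)
  then show ?thesis by blast
qed

theorem theorem5p3:
  fixes c \<phi> s0 :: real and K :: "real \<Rightarrow> real" and I :: "real set"
  assumes "\<phi> \<noteq> 0"
    and "is_interval I" and "interior I \<noteq> {}" and "s0 \<in> I" and "0 \<notin> I"
    and "continuous_on I K"
  shows "\<exists>z :: real \<Rightarrow> real \<Rightarrow> real \<Rightarrow> real.
    (\<forall>k0 k1. \<forall>J. is_interval J \<and> interior J \<noteq> {} \<and> J \<subseteq> I \<and> s0 \<in> J \<and>
        (\<forall>v\<in>J. radicand c \<phi> K s0 k1 v > 0) \<longrightarrow>
        (\<forall>s\<in>J. z k0 k1 s = k0 + (LBINT v=ereal s0..ereal s. sqrt (radicand c \<phi> K s0 k1 v))) \<and>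
        C2_curve J (generating_curve (\<lambda>s. s) (z k0 k1)) \<and>
        arclength_param J (generating_curve (\<lambda>s. s) (z k0 k1)) \<and>
        admissible J UNIV (helicoidal_surface c \<phi> (\<lambda>s. s) (z k0 k1)) \<and>
        (\<forall>s\<in>J. \<forall>t. gaussian_curvature J UNIV (helicoidal_surface c \<phi> (\<lambda>s. s) (z k0 k1)) s t = K s) \<and>
        k0 = z k0 k1 s0 \<and>
        k1 = (vector_derivative (z k0 k1) (at s0 within J))\<^sup>2 + c\<^sup>2 / (\<phi>\<^sup>2 * s0\<^sup>2)) \<and>
    (\<forall>k1 > c\<^sup>2 / (\<phi>\<^sup>2 * s0\<^sup>2). \<exists>J. is_interval J \<and> interior J \<noteq> {} \<and> J \<subseteq> I \<and> s0 \<in> J \<and>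
        openin (top_of_set I) J \<and> (\<forall>v\<in>J. radicand c \<phi> K s0 k1 v > 0))"
    (is "\<exists>z. (\<forall>k0 k1 J. ?good k1 J \<longrightarrow> ?concl z k0 k1 J) \<and> ?ex")
proof -
  define z where "z k0 k1 s = k0 + (LBINT v=ereal s0..ereal s. sqrt (radicand c \<phi> K s0 k1 v))"
    for k0 k1 s
  have "?concl z k0 k1 J" if "?good k1 J" for k0 k1 J
  proof -
    let ?R = "radicand c \<phi> K s0 k1"
    from that have J: "is_interval J" "interior J \<noteq> {}" "J \<subseteq> I" "s0 \<in> J"
      and pos: "\<And>v. v \<in> J \<Longrightarrow> ?R v > 0"
      by blast+
    have "0 \<notin> J" and K: "continuous_on J K"
      using J(3) assms(5,6) continuous_on_subset by blast+
    \<comment> \<open>\<open>p\<close> and \<open>q\<close> are the first and second derivatives of the profile; \<open>q\<close> is half the derivative of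
      the radicand, divided by its root.\<close>
    define p where "p s = sqrt (?R s)" for s
    define q where "q s = (c\<^sup>2 / (\<phi>\<^sup>2 * s ^ 3) + s * K s) / p s" for s
    have ppos: "p s > 0" if "s \<in> J" for s
      using pos[OF that] by (simp add: p_def)
    have pc: "continuous_on J p"
      unfolding p_def[abs_def]
      by (intro continuous_on_real_sqrt continuous_on_radicand J \<open>0 \<notin> J\<close> assms(1) K)
    have dz: "(z k0 k1 has_real_derivative p s) (at s within J)" if "s \<in> J" for s
    proof -
      have "((\<lambda>u. LBINT v=ereal s0..ereal u. p v) has_real_derivative p s) (at s within J)"
        using interval_integral_has_vector_derivative[OF J(1,4) that pc]
        by (simp add: has_real_derivative_iff_has_vector_derivative)
      from DERIV_add[OF DERIV_const this] show ?thesis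
        unfolding z_def[abs_def] p_def[symmetric] by simp
    qed
    have dp: "(p has_real_derivative q s) (at s within J)" if "s \<in> J" for s
    proof -
      have "(p has_real_derivative
          inverse (p s) / 2 * (2 * (c\<^sup>2 / (\<phi>\<^sup>2 * s ^ 3) + s * K s))) (at s within J)"
        unfolding p_def[abs_def]
        by (rule DERIV_chain2[OF DERIV_real_sqrt[OF pos[OF that]]
              radicand_has_real_derivative[OF J(1,4) that \<open>0 \<notin> J\<close> assms(1) K]])
      moreover
      have "inverse a / 2 * (2 * b) = b / a" for a b :: real
        by (simp add: field_simps)
      then have "inverse (p s) / 2 * (2 * (c\<^sup>2 / (\<phi>\<^sup>2 * s ^ 3) + s * K s)) = q s"
        unfolding q_def .
      ultimately show ?thesis by simp
    qed
    have qc: "continuous_on J q"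
    proof -
      have "\<forall>s\<in>J. p s \<noteq> 0" "\<forall>s\<in>J. \<phi>\<^sup>2 * s ^ 3 \<noteq> 0"
        using ppos \<open>0 \<notin> J\<close> assms(1) by force+
      then show ?thesis
        unfolding q_def[abs_def] by (intro continuous_intros K pc)
    qed
    have curv: "p s * q s / s - c\<^sup>2 / (\<phi>\<^sup>2 * s ^ 4) = K s" if "s \<in> J" for s
    proof -
      have "s \<noteq> 0" using that \<open>0 \<notin> J\<close> by auto
      moreover have "p s * q s = c\<^sup>2 / (\<phi>\<^sup>2 * s ^ 3) + s * K s"
        unfolding q_def using ppos[OF that] by simp
      ultimately show ?thesis
        using assms(1) by (simp add: field_simps power3_eq_cube power4_eq_xxxx)
    qed
    have "vector_derivative (z k0 k1) (at s0 within J) = p s0"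
      using interval_at_within_neq_bot[OF J(1,2,4)] dz[OF J(4)]
      by (simp add: vector_derivative_within has_real_derivative_iff_has_vector_derivative)
    then have "k1 = (vector_derivative (z k0 k1) (at s0 within J))\<^sup>2 + c\<^sup>2 / (\<phi>\<^sup>2 * s0\<^sup>2)"
      using pos[OF J(4)] by (simp add: p_def)
    then show ?thesis
      using arclength_profile[OF J(1,2) dz dp qc]
        helicoidal_arclength[OF J(1,2) \<open>0 \<notin> J\<close> assms(1) dz dp qc] curv
      by (simp add: z_def)
  qed
  moreover have ?ex
  proof (intro allI impI)
    fix k1 assume "k1 > c\<^sup>2 / (\<phi>\<^sup>2 * s0\<^sup>2)"
    then have "radicand c \<phi> K s0 k1 s0 > 0"
      by simp
    moreover have "continuous (at s0 within I) (radicand c \<phi> K s0 k1)"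
      using continuous_on_radicand[OF assms(2,4,5,1,6)] assms(4)
      by (simp add: continuous_on_eq_continuous_within)
    ultimately have "eventually (\<lambda>v. radicand c \<phi> K s0 k1 v > 0) (at s0 within I)"
      by (intro order_tendstoD(1)) (auto simp: continuous_within)
    then obtain e where e: "e > 0" "\<And>v. v \<in> I \<Longrightarrow> v \<noteq> s0 \<Longrightarrow> dist v s0 < e \<Longrightarrow>
        radicand c \<phi> K s0 k1 v > 0"
      unfolding eventually_at by blast
    let ?J = "I \<inter> ball s0 e"
    have "is_interval ?J"
      by (intro is_interval_Int assms(2) is_interval_ball_real)
    moreover have "interior ?J \<noteq> {}"
      using interior_interval_Int_ball[OF assms(2-4) e(1)] .
    moreover have "openin (top_of_set I) ?J"
      by (simp add: openin_open_Int)
    moreover have "\<forall>v\<in>?J. radicand c \<phi> K s0 k1 v > 0"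
      using e(2) \<open>radicand c \<phi> K s0 k1 s0 > 0\<close> by (metis IntD1 IntD2 dist_commute mem_ball)
    ultimately show "\<exists>J. is_interval J \<and> interior J \<noteq> {} \<and> J \<subseteq> I \<and> s0 \<in> J \<and>
        openin (top_of_set I) J \<and> (\<forall>v\<in>J. radicand c \<phi> K s0 k1 v > 0)"
      using assms(4) e(1) by (intro exI[of _ ?J]) auto
  qed
  ultimately show ?thesis
    by blast
qed

end
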